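(* Let $1\le r\le s$ and $n=r+s$, and let the interference graph be the complete bipartite graph $K_{r,s}$ with vertex bipartition $V=U\cup W$, $|U|=r$, $|W|=s$. Then: (1) The universal interference index satisfies $i(K_{r,s})\le\lceil\log_2(n+r)\rceil$, and equality holds when $r\le 4$. (2) In general, $i(K_{r,s})$ equals the smallest $m$ such that $s\le b_r(m)$. (3) $i(K_{r,s},U)=i(K_{r,s},W)=\lceil\log_2(n+1)\rceil$. (4) For any class $\mathcal{P}$ of nonempty subsets of $V$ that contains every pair $\{u,w\}$ with $u\in U$ and $w\in W$, $i(K_{r,s},\mathcal{P})=i(K_{r,s})$.
   Context: All graphs are finite and simple. Let $I$ be a graph with vertex set $V$ and let $X$ be a nonempty set (the ground set). An injective function $f: V\to 2^X\setminus\{\emptyset\}$ is an interference of a set $\emptyset\neq D\subseteq V$ with respect to $I$ if for every $u\in V\setminus D$ there exists $v\in D$ adjacent to $u$ in $I$ with $f(u)\cap f(v)\neq\emptyset$. A dominating set of $I$ is a nonempty $D\subseteq V$ such that every vertex is in $D$ or adjacent in $I$ to a vertex of $D$; only dominating sets can have an interference. For a class $\mathcal{P}$ of nonempty subsets of $V$ containing at least one dominating set, the interference index $i(I,\mathcal{P})$ is the smallest size $|X|$ of a ground set $X$ for which there is an injective $f: V\to 2^X\setminus\{\emptyset\}$ that is an interference with respect to $I$ of every dominating set belonging to $\mathcal{P}$. For a single set $D$, $i(I,D):=i(I,\{D\})$. The universal interference index is $i(I):=i(I,2^V\setminus\{\emptyset\})$, i.e. the smallest $|X|$ admitting an $f$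 that is an interference of every dominating set of $I$. For positive integers $r,m$, $b_r(m)$ denotes the largest number $t$ for which there exist $r+t$ distinct subsets of an $m$-element set such that every one of the first $r$ subsets intersects (has nonempty intersection with) every one of the last $t$ subsets (if $r>2^m$, no such $t$ exists and the condition $s\le b_r(m)$ is regarded as false). *)

theory Defs
  imports Complex_Main "Graph_Theory.Digraph"
begin

text \<open>
  A finite simple graph is a pre-digraph satisfying the locale predicate \<^const>\<open>graph\<close>: finite,
  without loops and parallel arcs, and symmetric, each edge being a pair of opposite arcs.
  Adjacency of \<open>u\<close> and \<open>v\<close> is \<open>u \<rightarrow>\<^bsub>G\<^esub> v\<close>.
\<close>

definition dominating_set :: "('a, 'b) pre_digraph \<Rightarrow> 'a set \<Rightarrow> bool" where
  "dominating_set G D \<longleftrightarrow>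
     D \<noteq> {} \<and> D \<subseteq> verts G \<and> (\<forall>u\<in>verts G. u \<in> D \<or> (\<exists>v\<in>D. u \<rightarrow>\<^bsub>G\<^esub> v))"

definition set_coding :: "('a, 'b) pre_digraph \<Rightarrow> 'x set \<Rightarrow> ('a \<Rightarrow> 'x set) \<Rightarrow> bool" where
  "set_coding G X f \<longleftrightarrow> X \<noteq> {} \<and> inj_on f (verts G) \<and> f ` verts G \<subseteq> Pow X - {{}}"

definition interference ::
  "('a, 'b) pre_digraph \<Rightarrow> 'x set \<Rightarrow> ('a \<Rightarrow> 'x set) \<Rightarrow> 'a set \<Rightarrow> bool" where
  "interference G X f D \<longleftrightarrow>
     set_coding G X f \<and> D \<noteq> {} \<and> D \<subseteq> verts G \<and>
     (\<forall>u\<in>verts G - D. \<exists>v\<in>D. u \<rightarrow>\<^bsub>G\<^esub> v \<and> f u \<inter> f v \<noteq> {})"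

text \<open>
  Since only the size of the ground set matters, ground sets are finite sets of natural numbers;
  \<open>interference_index_le\<close> below shows that this is no restriction, and
  \<open>interference_index_attained\<close> that the minimum always exists.
\<close>

definition interference_index :: "('a, 'b) pre_digraph \<Rightarrow> 'a set set \<Rightarrow> nat" where
  "interference_index G P =
     (LEAST m. \<exists>(X :: nat set) f. finite X \<and> card X = m \<and> set_coding G X f \<and>
        (\<forall>D\<in>P. dominating_set G D \<longrightarrow> interference G X f D))"

definition universal_interference_index :: "('a, 'b) pre_digraph \<Rightarrow> nat" where
  "universal_interference_index G = interference_index G (Pow (verts G) - {{}})"

definition cross_intersecting :: "nat \<Rightarrow> nat \<Rightarrow> nat \<Rightarrow> bool" where
  "cross_intersecting m r t \<longleftrightarrow>
     (\<exists>A B. A \<subseteq> Pow {..<m} \<and> B \<subseteq> Pow {..<m} \<and> card A = r \<and> card B = t \<and> A \<inter> B = {} \<and>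
        (\<forall>a\<in>A. \<forall>b\<in>B. a \<inter> b \<noteq> {}))"

text \<open>
  The number \<open>b\<^sub>r(m)\<close>. It is meaningful only if \<open>r \<le> 2 ^ m\<close>, and unspecified otherwise, so uses
  of it have to be guarded by this condition.
\<close>

definition b_num :: "nat \<Rightarrow> nat \<Rightarrow> nat" where
  "b_num r m = (GREATEST t. cross_intersecting m r t)"

lemma b_num_greatest:
  assumes "r \<le> 2 ^ m"
  shows "cross_intersecting m r (b_num r m)"
    and "cross_intersecting m r t \<Longrightarrow> t \<le> b_num r m"
proof -
  have bound: "t \<le> 2 ^ m" if t: "cross_intersecting m r t" for t
  proof -
    obtain B where "B \<subseteq> Pow {..<m}" "card B = t"
      using t unfolding cross_intersecting_def by blast
    then show ?thesis
      using card_mono[of "Pow {..<m}" B] by (simp add: card_Pow)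
  qed
  have "r \<le> card (Pow {..<m})"
    using assms by (simp add: card_Pow)
  then obtain A where "A \<subseteq> Pow {..<m}" "card A = r"
    by (rule obtain_subset_with_card_n)
  then have ex: "cross_intersecting m r 0"
    unfolding cross_intersecting_def by (intro exI[of _ A] exI[of _ "{}"]) auto
  show "cross_intersecting m r (b_num r m)"
    unfolding b_num_def by (rule GreatestI_nat[of _ 0 "2 ^ m"]) (use ex bound in auto)
  show "t \<le> b_num r m" if "cross_intersecting m r t"
    unfolding b_num_def by (rule Greatest_le_nat[of _ t "2 ^ m"]) (use that bound in auto)
qed

lemma set_coding_transfer:
  assumes "set_coding G X f" "inj_on h X"
  shows "set_coding G (h ` X) (\<lambda>v. h ` f v)"
    and "interference G X f D \<Longrightarrow> interference G (h ` X) (\<lambda>v. h ` f v) D"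
proof -
  have sub: "f v \<subseteq> X" "f v \<noteq> {}" if "v \<in> verts G" for v
    using assms(1) that unfolding set_coding_def by auto
  have "inj_on (\<lambda>v. h ` f v) (verts G)"
  proof (rule inj_onI)
    fix u v assume *: "u \<in> verts G" "v \<in> verts G" "h ` f u = h ` f v"
    then have "f u = f v"
      using inj_on_image_eq_iff[OF assms(2)] sub by blast
    then show "u = v"
      using assms(1) * unfolding set_coding_def inj_on_def by blast
  qed
  moreover have "h ` f v \<in> Pow (h ` X) - {{}}" if "v \<in> verts G" for v
    using sub[OF that] by (simp add: image_mono)
  moreover have "h ` X \<noteq> {}"
    using assms(1) unfolding set_coding_def by simp
  ultimately show coding: "set_coding G (h ` X) (\<lambda>v. h ` f v)"
    unfolding set_coding_def by (simp only: image_subset_iff) simp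
  show "interference G (h ` X) (\<lambda>v. h ` f v) D" if "interference G X f D"
    using that coding unfolding interference_def by blast
qed

lemma interference_index_le:
  fixes X :: "'x set"
  assumes "finite X" "set_coding G X f"
    and "\<And>D. D \<in> P \<Longrightarrow> dominating_set G D \<Longrightarrow> interference G X f D"
  shows "interference_index G P \<le> card X"
proof -
  obtain h :: "'x \<Rightarrow> nat" where h: "inj_on h X"
    using finite_imp_inj_to_nat_seg[OF assms(1)] by blast
  have "\<exists>(X' :: nat set) f. finite X' \<and> card X' = card X \<and> set_coding G X' f \<and>
      (\<forall>D\<in>P. dominating_set G D \<longrightarrow> interference G X' f D)"
  proof (intro exI conjI ballI impI)
    show "finite (h ` X)"
      using assms(1) by simp
    show "card (h ` X) = card X"
      using h by (rule card_image)
    show "set_coding G (h ` X) (\<lambda>v. h ` f v)"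
      by (rule set_coding_transfer(1)[OF assms(2) h])
    show "interference G (h ` X) (\<lambda>v. h ` f v) D" if "D \<in> P" "dominating_set G D" for D
      by (rule set_coding_transfer(2)[OF assms(2) h assms(3)[OF that]])
  qed
  then show ?thesis
    unfolding interference_index_def by (rule Least_le)
qed

lemma interference_index_attained:
  assumes "graph G"
  shows "\<exists>(X :: nat set) f. finite X \<and> card X = interference_index G P \<and> set_coding G X f \<and>
           (\<forall>D\<in>P. dominating_set G D \<longrightarrow> interference G X f D)"
proof -
  interpret graph G by fact
  obtain g :: "'a \<Rightarrow> nat" where g: "inj_on g (verts G)"
    using finite_imp_inj_to_nat_seg[OF finite_verts] by blast
  define X f where "X = insert 0 (Suc ` g ` verts G)" and "f v = {0, Suc (g v)}" for v
  have coding: "set_coding G X f"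
  proof -
    have "inj_on f (verts G)"
      unfolding f_def by (intro inj_onI inj_onD[OF g]) (simp_all add: doubleton_eq_iff)
    then show ?thesis
      unfolding set_coding_def X_def f_def by auto
  qed
  moreover have "interference G X f D" if "dominating_set G D" for D
  proof -
    have "f u \<inter> f v \<noteq> {}" for u v
      unfolding f_def by blast
    then show ?thesis
      using coding that unfolding interference_def dominating_set_def by (metis DiffD1 DiffD2)
  qed
  moreover have "finite X"
    unfolding X_def by simp
  ultimately have "\<exists>(X' :: nat set) f. finite X' \<and> card X' = card X \<and> set_coding G X' f \<and>
      (\<forall>D\<in>P. dominating_set G D \<longrightarrow> interference G X' f D)"
    by blast
  then show ?thesis
    unfolding interference_index_def by (rule LeastI)
qed

end

theory Submission
  imports Defs
begin

text \<open>
  In a complete bipartite graph every pair with one vertex on each side is dominating. Demanding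
  that a coding be an interference of all these pairs therefore forces every code on one side to
  meet every code on the other, and such a coding is an interference of all dominating sets. The
  only exception is the graph with a single edge, whose pair leaves no vertex to check; there the
  two codes need not meet, but two distinct nonempty sets already need two points, and on two
  points a coding with intersecting codes exists. So for all classes containing these pairs the
  index is the least \<open>m\<close> for which two disjoint cross-intersecting families of sizes \<open>r\<close> and \<open>s\<close>
  live on \<open>m\<close> points (\<open>index_eq_Least_cross_intersecting\<close>). Hence they all agree, are
  described by \<open>b_num\<close>, and the logarithmic bounds become a question of extremal set theory.

  A family \<open>B\<close> cross-intersects \<open>A\<close> exactly if it avoids the down-closure \<open>D\<close> of the complements
  of the members of \<open>A\<close>. If these complements already form a down-set, only the \<open>r\<close> members of
  \<open>A\<close> and the \<open>r\<close> complements are lost, whence \<open>2 * r + s \<le> 2 ^ m\<close> suffices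
  (\<open>cross_intersecting_if_le\<close>). The inequality is also necessary whenever \<open>A\<close> contains no two
  disjoint sets, since then \<open>A\<close> and \<open>D\<close> are disjoint. Disjoint members cost more room elsewhere:
  a singleton in \<open>A\<close> confines \<open>B\<close> to a half of the power set, and two disjoint members with at
  least two points each put at least seven sets into \<open>D\<close>. For \<open>r \<le> 4\<close> and \<open>r \<le> s\<close> this is always
  enough (\<open>cross_intersecting_imp_le\<close>).

  When interference is demanded for one side only, the \<open>n\<close> distinct nonempty codes give
  \<open>n + 1 \<le> 2 ^ m\<close>, and this suffices because a vertex of this side coded by the whole ground set
  serves all vertices of the other side.
\<close>

section \<open>Binary logarithms rounded up\<close>

lemma ceiling_log2_le_iff:
  assumes "N > 0"
  shows "\<lceil>log 2 (real N)\<rceil> \<le> int m \<longleftrightarrow> N \<le> 2 ^ m"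
proof -
  have "\<lceil>log 2 (real N)\<rceil> \<le> int m \<longleftrightarrow> log 2 (real N) \<le> real m"
    by (simp add: ceiling_le_iff)
  also have "\<dots> \<longleftrightarrow> real N \<le> 2 powr real m"
    using assms by (simp add: log_le_iff)
  also have "\<dots> \<longleftrightarrow> real N \<le> real (2 ^ m)"
    by (simp add: powr_realpow)
  also have "\<dots> \<longleftrightarrow> N \<le> 2 ^ m"
    by (rule of_nat_le_iff)
  finally show ?thesis .
qed

lemma least_exponent_eq_ceiling_log2:
  assumes "N > 0" "N \<le> 2 ^ k" "\<And>m. N \<le> 2 ^ m \<Longrightarrow> k \<le> m"
  shows "int k = \<lceil>log 2 (real N)\<rceil>"
proof (rule antisym)
  have "0 \<le> log 2 (real N)"
    using assms(1) by simp
  then have "\<lceil>log 2 (real N)\<rceil> \<le> int (nat \<lceil>log 2 (real N)\<rceil>)"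
    by simp
  then have "k \<le> nat \<lceil>log 2 (real N)\<rceil>"
    using assms(3) ceiling_log2_le_iff[OF assms(1)] by blast
  then show "int k \<le> \<lceil>log 2 (real N)\<rceil>"
    using \<open>0 \<le> log 2 (real N)\<close> by linarith
  show "\<lceil>log 2 (real N)\<rceil> \<le> int k"
    using assms(1,2) ceiling_log2_le_iff by blast
qed

section \<open>Cross-intersecting families\<close>

lemma cross_intersecting_mono:
  assumes "cross_intersecting m r t" "s \<le> t"
  shows "cross_intersecting m r s"
proof -
  obtain A B where AB: "A \<subseteq> Pow {..<m}" "B \<subseteq> Pow {..<m}" "card A = r" "card B = t"
      "A \<inter> B = {}" "\<forall>a\<in>A. \<forall>b\<in>B. a \<inter> b \<noteq> {}"
    using assms(1) unfolding cross_intersecting_def by blast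
  obtain B' where B': "B' \<subseteq> B" "card B' = s"
    using obtain_subset_with_card_n assms(2) AB(4) by metis
  have "B' \<subseteq> Pow {..<m}" "A \<inter> B' = {}" "\<forall>a\<in>A. \<forall>b\<in>B'. a \<inter> b \<noteq> {}"
    using AB(2,5,6) B'(1) by blast+
  then show ?thesis
    unfolding cross_intersecting_def using AB(1,3) B'(2)
    by (intro exI[of _ A] exI[of _ B'] conjI)
qed

lemma cross_intersecting_iff_le_b_num:
  "cross_intersecting m r s \<longleftrightarrow> r \<le> 2 ^ m \<and> s \<le> b_num r m"
proof
  assume cross: "cross_intersecting m r s"
  then obtain A where "A \<subseteq> Pow {..<m}" "card A = r"
    unfolding cross_intersecting_def by blast
  then have "r \<le> 2 ^ m"
    using card_mono[of "Pow {..<m}" A] by (simp add: card_Pow)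
  then show "r \<le> 2 ^ m \<and> s \<le> b_num r m"
    using b_num_greatest(2) cross by blast
next
  assume "r \<le> 2 ^ m \<and> s \<le> b_num r m"
  then show "cross_intersecting m r s"
    using b_num_greatest(1) cross_intersecting_mono by blast
qed

text \<open>
  Down-sets of every size exist because a proper down-set can always be enlarged by a minimal
  set outside it.
\<close>

lemma ex_down_set_of_card:
  assumes "finite S" "k \<le> 2 ^ card S"
  shows "\<exists>C \<subseteq> Pow S. card C = k \<and> (\<forall>c\<in>C. Pow c \<subseteq> C)"
  using assms(2)
proof (induction k)
  case 0
  show ?case
    by (rule exI[of _ "{}"]) simp
next
  case (Suc k)
  then obtain C where C: "C \<subseteq> Pow S" "card C = k" "\<forall>c\<in>C. Pow c \<subseteq> C"
    by auto
  have fin: "finite C" "finite (Pow S - C)"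
    using C(1) assms(1) by (auto intro: finite_subset)
  have "C \<noteq> Pow S"
    using C(2) Suc.prems assms(1) by (auto simp: card_Pow)
  then have "Pow S - C \<noteq> {}"
    using C(1) by blast
  then obtain c where c: "c \<in> Pow S - C" "\<forall>b\<in>Pow S - C. b \<subseteq> c \<longrightarrow> c = b"
    using finite_has_minimal[OF fin(2)] by blast
  have "insert c C \<subseteq> Pow S"
    using C(1) c(1) by blast
  moreover have "card (insert c C) = Suc k"
    using C(2) c(1) fin(1) by simp
  moreover have "Pow c \<subseteq> insert c C"
    using c by auto
  then have "\<forall>d\<in>insert c C. Pow d \<subseteq> insert c C"
    using C(3) by blast
  ultimately show ?case
    by blast
qed

lemma cross_intersecting_if_le:
  assumes "2 * r + s \<le> 2 ^ m"
  shows "cross_intersecting m r s"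
proof -
  define S where "S = {..<m}"
  have S: "finite S" "card S = m"
    unfolding S_def by simp_all
  obtain C where C: "C \<subseteq> Pow S" "card C = r" "\<forall>c\<in>C. Pow c \<subseteq> C"
    using ex_down_set_of_card[of S r] S assms by auto
  define A where "A = (\<lambda>c. S - c) ` C"
  have "inj_on (\<lambda>c. S - c) C"
    using C(1) by (intro inj_onI) blast
  then have A: "card A = r" "A \<subseteq> Pow S"
    unfolding A_def using C(2) by (auto simp: card_image)
  have "finite (A \<union> C)" "A \<union> C \<subseteq> Pow S"
    using A(2) C(1) S(1) by (auto intro: finite_subset)
  then have "card (Pow S - (A \<union> C)) = 2 ^ m - card (A \<union> C)"
    using S by (simp add: card_Diff_subset card_Pow)
  moreover have "card (A \<union> C) \<le> 2 * r"
    using card_Un_le[of A C] A(1) C(2) by simp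
  ultimately have "s \<le> card (Pow S - (A \<union> C))"
    using assms by simp
  then obtain B where B: "B \<subseteq> Pow S - (A \<union> C)" "card B = s"
    by (rule obtain_subset_with_card_n)
  have "a \<inter> b \<noteq> {}" if "a \<in> A" "b \<in> B" for a b
  proof
    assume "a \<inter> b = {}"
    moreover obtain c where "c \<in> C" "a = S - c"
      using \<open>a \<in> A\<close> unfolding A_def by blast
    ultimately have "b \<in> Pow c"
      using B(1) \<open>b \<in> B\<close> by blast
    then have "b \<in> C"
      using C(3) \<open>c \<in> C\<close> by blast
    then show False
      using B(1) \<open>b \<in> B\<close> by blast
  qed
  moreover have "A \<inter> B = {}"
    using B(1) by blast
  ultimately show ?thesis
    unfolding cross_intersecting_def using A B S_def by (intro exI[of _ A] exI[of _ B]) blast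
qed

text \<open>
  If \<open>{i} \<in> A\<close>, all members of \<open>B\<close> contain \<open>i\<close>, and \<open>B\<close> lies among the \<open>2 ^ (m - 1) - 1\<close> other
  sets with this property. As \<open>A\<close> is no larger than \<open>B\<close> and has at most four members, this is
  enough, unless \<open>B\<close> consists of all these sets on three points; but then \<open>{i}\<close> and its complement are the only
  sets that \<open>A\<close> can contain.
\<close>

lemma cross_intersecting_singleton_imp_le:
  fixes A B :: "'x set set"
  assumes S: "finite S" "card S = m"
    and sub: "A \<subseteq> Pow S" "B \<subseteq> Pow S"
    and disj: "A \<inter> B = {}"
    and cross: "\<And>a b. a \<in> A \<Longrightarrow> b \<in> B \<Longrightarrow> a \<inter> b \<noteq> {}"
    and le: "card A \<le> card B" "card A \<le> 4"
    and i: "{i} \<in> A"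
  shows "2 * card A + card B \<le> 2 ^ m"
proof -
  define F where "F = insert i ` (Pow (S - {i}) - {{}})"
  have iS: "i \<in> S"
    using i sub(1) by blast
  have "inj_on (insert i) (Pow (S - {i}) - {{}})"
    by (rule inj_onI) blast
  then have "card F = card (Pow (S - {i}) - {{}})"
    unfolding F_def by (rule card_image)
  also have "\<dots> = 2 ^ (m - 1) - 1"
    using S iS by (simp add: card_Pow)
  finally have card_F: "card F = 2 ^ (m - 1) - 1" .
  have "finite F"
    unfolding F_def using S(1) by simp
  have F_iff: "b \<in> F \<longleftrightarrow> i \<in> b \<and> b \<subseteq> S \<and> b \<noteq> {i}" for b
  proof
    assume b: "i \<in> b \<and> b \<subseteq> S \<and> b \<noteq> {i}"
    then have "b = insert i (b - {i})" "b - {i} \<in> Pow (S - {i}) - {{}}"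
      by blast+
    then show "b \<in> F"
      unfolding F_def by (rule image_eqI)
  qed (use iS in \<open>auto simp: F_def\<close>)
  have "B \<subseteq> F"
  proof
    fix b assume "b \<in> B"
    then have "i \<in> b" "b \<subseteq> S" "b \<noteq> {i}"
      using cross[OF i] sub(2) disj i by blast+
    then show "b \<in> F"
      by (simp add: F_iff)
  qed
  then have card_B: "card B \<le> 2 ^ (m - 1) - 1"
    using card_mono[OF \<open>finite F\<close>] card_F by metis
  have "finite A"
    using sub(1) S(1) by (auto intro: finite_subset)
  then have card_A: "1 \<le> card A"
    using i by (metis One_nat_def Suc_leI card_gt_0_iff empty_iff)
  have exceptional: False if "m = 3" "card A = 3" "card B = 3"
  proof -
    have "B = F"
      using \<open>B \<subseteq> F\<close> \<open>finite F\<close> card_F that by (simp add: card_subset_eq)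
    have "a = {i} \<or> a = S - {i}" if a: "a \<in> A" for a
    proof (cases "i \<in> a")
      case True
      moreover have "a \<notin> F"
        using a disj \<open>B = F\<close> by blast
      moreover have "a \<subseteq> S"
        using a sub(1) by blast
      ultimately show ?thesis
        by (simp add: F_iff)
    next
      case False
      have "j \<in> a" if "j \<in> S - {i}" for j
      proof -
        have "{i, j} \<in> B"
          using that iS \<open>B = F\<close> F_iff by auto
        then show ?thesis
          using cross[OF a] False by blast
      qed
      then show ?thesis
        using False sub(1) a by blast
    qed
    then have "A \<subseteq> {{i}, S - {i}}"
      by blast
    then have "card A \<le> 2"
      using card_mono[of "{{i}, S - {i}}" A] card_insert_le_m1[of 2 "{S - {i}}" "{i}"] by simp
    then show False
      using that by simp
  qed
  consider "m = 0" | "m = 1" | "m = 2" | "m = 3" | k where "m = k + 4"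
  proof -
    have "m < 4 \<or> m = (m - 4) + 4"
      by linarith
    then show ?thesis
      using that by (auto simp: less_Suc_eq numeral_eq_Suc)
  qed
  then show ?thesis
  proof cases
    case 4
    then have "card B \<le> 3"
      using card_B by simp
    then show ?thesis
      using 4 le exceptional by (cases "card A = 3") auto
  next
    case (5 k)
    have "(1::nat) \<le> 2 ^ k"
      by simp
    moreover have "card B \<le> 8 * 2 ^ k - 1" "(2::nat) ^ m = 16 * 2 ^ k"
      using card_B 5 by (simp_all add: power_add)
    ultimately show ?thesis
      using le by linarith
  qed (use card_A card_B le in auto)
qed

text \<open>
  \<open>D\<close> is the down-closure of the complements of members of \<open>A\<close>; it has at least \<open>card A\<close> elements
  and avoids \<open>B\<close>, so it suffices to find \<open>2 * r\<close> sets in \<open>A \<union> D\<close>. If \<open>D\<close> meets \<open>A\<close>, then \<open>A\<close> has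
  two disjoint members, and \<open>D\<close> contains all their subsets.
\<close>

lemma cross_intersecting_imp_le:
  assumes cr: "cross_intersecting m r s" and r: "1 \<le> r" "r \<le> s" "r \<le> 4"
  shows "2 * r + s \<le> 2 ^ m"
proof -
  define S where "S = {..<m}"
  have S: "finite S" "card S = m"
    unfolding S_def by simp_all
  obtain A B where sub: "A \<subseteq> Pow S" "B \<subseteq> Pow S" and card: "card A = r" "card B = s"
    and disj: "A \<inter> B = {}" and cross': "\<forall>a\<in>A. \<forall>b\<in>B. a \<inter> b \<noteq> {}"
    using cr unfolding cross_intersecting_def S_def by blast
  have cross: "a \<inter> b \<noteq> {}" if "a \<in> A" "b \<in> B" for a b
    using cross' that by blast
  define D where "D = {d \<in> Pow S. \<exists>a\<in>A. d \<inter> a = {}}"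
  have fin: "finite A" "finite B" "finite D"
    using sub S(1) unfolding D_def by (auto intro: finite_subset)
  have "B \<inter> D = {}" "D \<subseteq> Pow S"
    unfolding D_def using cross by blast+
  have enough: ?thesis if "2 * r \<le> card (A \<union> D)"
  proof -
    have "card (A \<union> D) + card B = card (A \<union> D \<union> B)"
      using fin disj \<open>B \<inter> D = {}\<close> by (subst card_Un_disjoint) auto
    also have "\<dots> \<le> card (Pow S)"
      using sub \<open>D \<subseteq> Pow S\<close> S(1) by (intro card_mono) auto
    finally show ?thesis
      using that card S by (simp add: card_Pow)
  qed
  have "{} \<notin> A"
  proof
    assume "{} \<in> A"
    moreover have "B \<noteq> {}"
      using card r by auto
    ultimately show False
      using cross by blast
  qed
  consider i where "{i} \<in> A" | "A \<inter> D = {}" | "A \<inter> D \<noteq> {}" "\<forall>i. {i} \<notin> A"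
    by blast
  then show ?thesis
  proof cases
    case 1
    then show ?thesis
      using cross_intersecting_singleton_imp_le[OF S sub disj cross] card r by simp
  next
    case 2
    have "(\<lambda>a. S - a) ` A \<subseteq> D"
      unfolding D_def by blast
    moreover have "inj_on (\<lambda>a. S - a) A"
      using sub(1) by (intro inj_onI) blast
    ultimately have "r \<le> card D"
      using card_inj_on_le fin(3) card(1) by metis
    then show ?thesis
      using enough card fin 2 by (simp add: card_Un_disjoint)
  next
    case 3
    then obtain a a' where a: "a \<in> A" "a' \<in> A" "a \<inter> a' = {}"
      unfolding D_def by blast
    have two_points: "\<exists>x y. x \<in> c \<and> y \<in> c \<and> x \<noteq> y" if "c \<in> A" for c
    proof -
      have "c \<noteq> {}"
        using that \<open>{} \<notin> A\<close> by blast
      then obtain x where "x \<in> c"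
        by blast
      moreover have "c \<noteq> {x}"
        using that 3(2) by blast
      ultimately show ?thesis
        by blast
    qed
    obtain p q where pq: "p \<in> a" "q \<in> a" "p \<noteq> q"
      using two_points a(1) by blast
    obtain p' q' where pq': "p' \<in> a'" "q' \<in> a'" "p' \<noteq> q'"
      using two_points a(2) by blast
    define E where "E = {{}, {p}, {q}, {p, q}, {p'}, {q'}, {p', q'}}"
    have "p \<noteq> p'" "p \<noteq> q'" "q \<noteq> p'" "q \<noteq> q'"
      using a(3) pq pq' by blast+
    then have card_E: "card E = 7"
      unfolding E_def using pq(3) pq'(3) by (simp add: doubleton_eq_iff)
    have "Pow c \<subseteq> D" if "c \<in> A" "c' \<in> A" "c \<inter> c' = {}" for c c'
    proof
      fix d assume "d \<in> Pow c"
      then have "d \<subseteq> S" "d \<inter> c' = {}"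
        using that sub(1) by blast+
      then show "d \<in> D"
        unfolding D_def using that(2) by blast
    qed
    from this[OF a] this[OF a(2,1)] have "Pow a \<subseteq> D" "Pow a' \<subseteq> D"
      using a(3) by (simp_all add: Int_commute)
    moreover have "E \<subseteq> Pow a \<union> Pow a'"
      unfolding E_def using pq pq' by simp
    ultimately have "E \<subseteq> D"
      by blast
    show ?thesis
    proof (cases "r \<le> 3")
      case True
      have "7 \<le> card (A \<union> D)"
        using card_mono[of "A \<union> D" E] fin \<open>E \<subseteq> D\<close> card_E by auto
      then show ?thesis
        using enough True by simp
    next
      case False
      \<comment> \<open>Only the two pairs in \<open>E\<close> can belong to \<open>A\<close>, so four sets in \<open>A\<close> exceed \<open>E\<close>.\<close>
      have "\<not> A \<subseteq> E"
      proof
        assume "A \<subseteq> E"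
        then have "A \<subseteq> {{p, q}, {p', q'}}"
          using \<open>{} \<notin> A\<close> 3(2) unfolding E_def by blast
        then have "card A \<le> 2"
          using card_mono[of "{{p, q}, {p', q'}}" A]
            card_insert_le_m1[of 2 "{{p', q'}}" "{p, q}"] by simp
        then show False
          using card(1) False by simp
      qed
      then have "E \<subset> A \<union> D"
        using \<open>E \<subseteq> D\<close> by blast
      then have "7 < card (A \<union> D)"
        using psubset_card_mono[of "A \<union> D" E] fin card_E by simp
      then show ?thesis
        using enough r by simp
    qed
  qed
qed

section \<open>Codings of complete bipartite graphs\<close>

lemma dominated_interferenceI:
  assumes "set_coding G X f" "dominating_set G D"
    and "\<And>u v. u \<in> verts G - D \<Longrightarrow> v \<in> D \<Longrightarrow> u \<rightarrow>\<^bsub>G\<^esub> v \<Longrightarrow> f u \<inter> f v \<noteq> {}"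
  shows "interference G X f D"
  using assms unfolding interference_def dominating_set_def by (metis DiffD1 DiffD2)

lemma set_coding_card_le:
  assumes "finite X" "set_coding G X f"
  shows "card (verts G) + 1 \<le> 2 ^ card X"
proof -
  have "card (verts G) \<le> card (Pow X - {{}})"
    using assms unfolding set_coding_def by (intro card_inj_on_le[of f]) auto
  also have "\<dots> = 2 ^ card X - 1"
    using assms(1) by (simp add: card_Pow)
  finally show ?thesis
    by (simp add: le_diff_conv2)
qed

locale complete_bipartite =
  fixes G :: "('a, 'b) pre_digraph" and U W :: "'a set"
  assumes graph: "graph G"
    and verts: "verts G = U \<union> W" and disjoint: "U \<inter> W = {}"
    and nonempty: "U \<noteq> {}" "W \<noteq> {}"
    and arcs: "arcs_ends G = U \<times> W \<union> W \<times> U"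
begin

lemma finite_verts: "finite (verts G)" "finite U" "finite W"
proof -
  interpret graph G by (rule graph)
  show "finite (verts G)"
    by simp
  then show "finite U" "finite W"
    unfolding verts by simp_all
qed

lemma card_verts: "card (verts G) = card U + card W"
  unfolding verts using finite_verts disjoint by (simp add: card_Un_disjoint)

lemma swap: "complete_bipartite G W U"
proof (rule complete_bipartite.intro)
  show "verts G = W \<union> U" "W \<inter> U = {}" "arcs_ends G = W \<times> U \<union> U \<times> W"
    using verts disjoint arcs by blast+
qed (fact graph nonempty)+

lemma pair_dominating:
  assumes "u \<in> U" "w \<in> W"
  shows "dominating_set G {u, w}"
proof -
  have "x \<in> {u, w} \<or> (\<exists>v\<in>{u, w}. (x, v) \<in> arcs_ends G)" if "x \<in> verts G" for x
  proof (cases "x \<in> U")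
    case True
    then have "(x, w) \<in> arcs_ends G"
      unfolding arcs using assms by simp
    then show ?thesis
      by simp
  next
    case False
    then have "(x, u) \<in> arcs_ends G"
      using that unfolding arcs verts using assms by simp
    then show ?thesis
      by simp
  qed
  moreover have "{u, w} \<subseteq> verts G"
    using assms verts by simp
  ultimately show ?thesis
    unfolding dominating_set_def by simp
qed

text \<open>
  For \<open>u \<in> U\<close> and \<open>w \<in> W\<close> the codes must meet as soon as there is another vertex: if it is
  \<open>u' \<in> U\<close>, then \<open>u\<close> has no neighbour in the dominating set \<open>{u', w}\<close> but \<open>w\<close>, and similarly
  for a vertex in \<open>W\<close>.
\<close>

lemma cross_if_interference_of_pairs:
  assumes pairs: "\<And>u w. u \<in> U \<Longrightarrow> w \<in> W \<Longrightarrow> interference G X f {u, w}"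
    and big: "card U + card W \<noteq> 2" and uw: "u \<in> U" "w \<in> W"
  shows "f u \<inter> f w \<noteq> {}"
proof -
  have "U \<noteq> {u} \<or> W \<noteq> {w}"
    using big by auto
  then consider u' where "u' \<in> U" "u' \<noteq> u" | w' where "w' \<in> W" "w' \<noteq> w"
    using uw by blast
  then show ?thesis
  proof cases
    case 1
    have "u \<in> verts G - {u', w}"
      using uw 1 disjoint unfolding verts by blast
    then obtain v where "v \<in> {u', w}" "(u, v) \<in> arcs_ends G" "f u \<inter> f v \<noteq> {}"
      using pairs[OF 1(1) uw(2)] unfolding interference_def by blast
    then show ?thesis
      using 1 uw disjoint unfolding arcs by blast
  next
    case 2
    have "w \<in> verts G - {u, w'}"
      using uw 2 disjoint unfolding verts by blast
    then obtain v where "v \<in> {u, w'}" "(w, v) \<in> arcs_ends G" "f w \<inter> f v \<noteq> {}"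
      using pairs[OF uw(1) 2(1)] unfolding interference_def by blast
    then show ?thesis
      using 2 uw disjoint unfolding arcs by blast
  qed
qed

lemma cross_intersecting_if_coding:
  fixes X :: "'x set"
  assumes X: "finite X" and coding: "set_coding G X f"
    and pairs: "\<And>u w. u \<in> U \<Longrightarrow> w \<in> W \<Longrightarrow> interference G X f {u, w}"
  shows "cross_intersecting (card X) (card U) (card W)"
proof (cases "card U + card W = 2")
  case True
  \<comment> \<open>The two codes need not meet here, but being distinct and nonempty they need two points.\<close>
  have "card U \<noteq> 0" "card W \<noteq> 0"
    using finite_verts nonempty by simp_all
  then have "card U = 1" "card W = 1"
    using True by simp_all
  then show ?thesis
    using set_coding_card_le[OF X coding] card_verts
    by (intro cross_intersecting_if_le) simp
next
  case False
  obtain h where h: "bij_betw h X {..<card X}"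
    using ex_bij_betw_finite_nat[OF X] by (auto simp: atLeast0LessThan)
  define g where "g v = h ` f v" for v
  have g: "set_coding G {..<card X} g"
    using set_coding_transfer(1)[OF coding, of h] h unfolding g_def bij_betw_def by simp
  then have inj: "inj_on g (U \<union> W)"
    unfolding set_coding_def verts by blast
  have "g ` U \<subseteq> Pow {..<card X}" "g ` W \<subseteq> Pow {..<card X}"
    using g unfolding set_coding_def verts by blast+
  moreover have "card (g ` U) = card U" "card (g ` W) = card W"
    using inj by (auto intro: card_image inj_on_subset)
  moreover have "g ` U \<inter> g ` W = {}"
    using inj disjoint inj_on_image_Int[of g "U \<union> W" U W] by simp
  moreover have "\<forall>a\<in>g ` U. \<forall>b\<in>g ` W. a \<inter> b \<noteq> {}"
  proof -
    have "g u \<inter> g w \<noteq> {}" if "u \<in> U" "w \<in> W" for u w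
      using cross_if_interference_of_pairs[OF pairs False that] unfolding g_def by blast
    then show ?thesis
      by simp
  qed
  ultimately show ?thesis
    unfolding cross_intersecting_def by (intro exI[of _ "g ` U"] exI[of _ "g ` W"] conjI)
qed

lemma interference_index_le_if_cross_intersecting:
  assumes "cross_intersecting m (card U) (card W)"
  shows "interference_index G P \<le> m"
proof -
  obtain A B where sub: "A \<subseteq> Pow {..<m}" "B \<subseteq> Pow {..<m}"
    and card: "card A = card U" "card B = card W"
    and AB: "A \<inter> B = {}" and cross: "\<forall>a\<in>A. \<forall>b\<in>B. a \<inter> b \<noteq> {}"
    using assms unfolding cross_intersecting_def by (elim exE conjE) (rule that)
  have fin: "finite A" "finite B"
    using sub by (auto intro: finite_subset)
  obtain g where g: "bij_betw g U A"
    using finite_same_card_bij[OF finite_verts(2) fin(1)] card by metis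
  obtain h where h: "bij_betw h W B"
    using finite_same_card_bij[OF finite_verts(3) fin(2)] card by metis
  define f where "f v = (if v \<in> U then g v else h v)" for v
  have "f v = h v" if "v \<in> W" for v
    using that disjoint by (auto simp: f_def)
  then have f: "bij_betw f U A" "bij_betw f W B"
    using g h bij_betw_cong[of U f g A] bij_betw_cong[of W f h B] by (simp_all add: f_def)
  have inj: "inj_on f (verts G)" and image: "f ` verts G = A \<union> B"
    using bij_betw_combine[OF f AB] unfolding bij_betw_def verts by blast+
  have meet: "f u \<inter> f w \<noteq> {}" if "u \<in> U" "w \<in> W" for u w
    using cross f that by (meson bij_betwE)
  have ne: "f v \<noteq> {}" if "v \<in> verts G" for v
    using that meet nonempty unfolding verts by blast
  have "f ` verts G \<subseteq> Pow {..<m}"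
    unfolding image using sub by simp
  then have sub': "f ` verts G \<subseteq> Pow {..<m} - {{}}"
    using ne by auto
  moreover have "{..<m} \<noteq> {}"
  proof -
    obtain u where "u \<in> verts G"
      using nonempty unfolding verts by blast
    then show ?thesis
      using sub' by blast
  qed
  ultimately have coding: "set_coding G {..<m} f"
    using inj unfolding set_coding_def by simp
  have "interference G {..<m} f D" if "dominating_set G D" for D
  proof (rule dominated_interferenceI[OF coding that])
    fix u v assume "(u, v) \<in> arcs_ends G"
    then show "f u \<inter> f v \<noteq> {}"
      using meet unfolding arcs by blast
  qed
  then have "interference_index G P \<le> card {..<m}"
    by (intro interference_index_le[OF _ coding]) auto
  then show ?thesis
    by simp
qed

lemma index_eq_Least_cross_intersecting:
  assumes pairs: "\<And>u w. u \<in> U \<Longrightarrow> w \<in> W \<Longrightarrow> {u, w} \<in> P"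
  shows "interference_index G P = (LEAST m. cross_intersecting m (card U) (card W))"
proof -
  obtain X :: "nat set" and f where X: "finite X" "card X = interference_index G P"
    and coding: "set_coding G X f"
    and intf: "\<forall>D\<in>P. dominating_set G D \<longrightarrow> interference G X f D"
    using interference_index_attained[OF graph] by metis
  have "cross_intersecting (interference_index G P) (card U) (card W)"
    using cross_intersecting_if_coding[OF X(1) coding] intf pairs pair_dominating X(2) by metis
  then show ?thesis
    using interference_index_le_if_cross_intersecting by (intro Least_equality[symmetric])
qed

lemma universal_index_eq_Least_cross_intersecting:
  "universal_interference_index G = (LEAST m. cross_intersecting m (card U) (card W))"
  unfolding universal_interference_index_def
  by (rule index_eq_Least_cross_intersecting) (simp add: verts)

lemma cross_intersecting_universal_index:
  "cross_intersecting (universal_interference_index G) (card U) (card W)"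
proof -
  have "cross_intersecting (2 * card U + card W) (card U) (card W)"
    by (rule cross_intersecting_if_le) (rule less_imp_le, rule less_exp)
  then show ?thesis
    unfolding universal_index_eq_Least_cross_intersecting by (rule LeastI)
qed

lemma universal_index_le:
  "cross_intersecting m (card U) (card W) \<Longrightarrow> universal_interference_index G \<le> m"
  unfolding universal_index_eq_Least_cross_intersecting by (rule Least_le)

text \<open>
  Coding one vertex of \<open>U\<close> by the whole ground set makes \<open>U\<close> serve every vertex of \<open>W\<close>, whatever
  the other codes are.
\<close>

lemma side_index_le:
  assumes "card U + card W + 1 \<le> 2 ^ m"
  shows "interference_index G {U} \<le> m"
proof -
  obtain u0 where u0: "u0 \<in> U"
    using nonempty by blast
  have m: "m > 0"
    using assms finite_verts nonempty by (cases m) auto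
  then have S: "{..<m} \<noteq> {}"
    by auto
  have "finite (Pow {..<m} - {{}, {..<m}})"
    by simp
  moreover have "card (verts G - {u0}) \<le> card (Pow {..<m} - {{}, {..<m}})"
  proof -
    have "card (Pow {..<m} - {{}, {..<m}}) = 2 ^ m - 2"
      using S by (subst card_Diff_subset) (auto simp: card_Pow)
    moreover have "card (verts G - {u0}) = card U + card W - 1"
      using u0 finite_verts card_verts by (simp add: verts)
    ultimately show ?thesis
      using assms by simp
  qed
  ultimately obtain g where g: "inj_on g (verts G - {u0})"
      "g ` (verts G - {u0}) \<subseteq> Pow {..<m} - {{}, {..<m}}"
    using card_le_inj[of "verts G - {u0}" "Pow {..<m} - {{}, {..<m}}"] finite_verts(1) by auto
  define f where "f = g(u0 := {..<m})"
  have coding: "set_coding G {..<m} f"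
  proof -
    have "inj_on f (insert u0 (verts G - {u0}))"
      unfolding f_def using g by (subst inj_on_insert) (auto simp: inj_on_def)
    moreover have "insert u0 (verts G - {u0}) = verts G"
      using u0 verts by blast
    moreover have "f v \<in> Pow {..<m} - {{}}" if "v \<in> verts G" for v
      using g(2) S that unfolding f_def by (cases "v = u0") auto
    ultimately show ?thesis
      using S unfolding set_coding_def by auto
  qed
  have "interference G {..<m} f U"
  proof -
    have "(w, u0) \<in> arcs_ends G \<and> f w \<inter> f u0 \<noteq> {}" if "w \<in> verts G - U" for w
    proof -
      have "f w \<noteq> {}" "f w \<subseteq> {..<m}"
        using coding that unfolding set_coding_def by auto
      then show ?thesis
        using that u0 unfolding arcs verts f_def by auto
    qed
    then show ?thesis
      using coding u0 unfolding interference_def verts by blast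
  qed
  then have "interference_index G {U} \<le> card {..<m}"
    by (intro interference_index_le[OF _ coding]) auto
  then show ?thesis
    by simp
qed

lemma side_index_eq:
  "int (interference_index G {U}) = \<lceil>log 2 (real (card U + card W + 1))\<rceil>"
proof (rule least_exponent_eq_ceiling_log2)
  obtain X :: "nat set" and f where X: "finite X" "card X = interference_index G {U}"
    and coding: "set_coding G X f"
    using interference_index_attained[OF graph] by metis
  show "card U + card W + 1 \<le> 2 ^ interference_index G {U}"
    using set_coding_card_le[OF X(1) coding] card_verts X(2) by simp
qed (use side_index_le in auto)

end

section \<open>The interference indices of complete bipartite graphs\<close>

theorem theorem3p5:
  fixes G :: "('a, 'b) pre_digraph" and U W :: "'a set" and r s n :: nat
  assumes "1 \<le> r" and "r \<le> s" and "n = r + s"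
    and "graph G"
    and "verts G = U \<union> W" and "U \<inter> W = {}" and "card U = r" and "card W = s"
    and "arcs_ends G = U \<times> W \<union> W \<times> U"
  shows
    "(int (universal_interference_index G) \<le> \<lceil>log 2 (real (n + r))\<rceil> \<and>
      (r \<le> 4 \<longrightarrow> int (universal_interference_index G) = \<lceil>log 2 (real (n + r))\<rceil>))
     \<and>
     (r \<le> 2 ^ universal_interference_index G \<and>
      s \<le> b_num r (universal_interference_index G) \<and>
      1 \<le> universal_interference_index G \<and>
      (\<forall>m\<ge>1. r \<le> 2 ^ m \<and> s \<le> b_num r m \<longrightarrow> universal_interference_index G \<le> m))
     \<and>
     (int (interference_index G {U}) = \<lceil>log 2 (real (n + 1))\<rceil> \<and>
      int (interference_index G {W}) = \<lceil>log 2 (real (n + 1))\<rceil>)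
     \<and>
     (\<forall>P. P \<subseteq> Pow (verts G) - {{}} \<longrightarrow> (\<forall>u\<in>U. \<forall>w\<in>W. {u, w} \<in> P) \<longrightarrow>
        interference_index G P = universal_interference_index G)"
proof -
  have "U \<noteq> {}" "W \<noteq> {}"
    using assms(1,2,7,8) by force+
  then interpret complete_bipartite G U W
    by (rule complete_bipartite.intro[OF assms(4-6) _ _ assms(9)])
  let ?i = "universal_interference_index G"
  have cross: "cross_intersecting ?i r s"
    and least: "\<And>m. cross_intersecting m r s \<Longrightarrow> ?i \<le> m"
    using cross_intersecting_universal_index universal_index_le assms(7,8) by simp_all
  have n: "n + r = 2 * r + s" "n + r > 0"
    using assms(1,3) by simp_all

  have upper: "int ?i \<le> \<lceil>log 2 (real (n + r))\<rceil>"
  proof -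
    have "0 \<le> log 2 (real (n + r))"
      using n(2) by (intro zero_le_log_cancel_iff[THEN iffD2]) linarith+
    then have "\<lceil>log 2 (real (n + r))\<rceil> \<ge> 0"
      by linarith
    then obtain k where k: "\<lceil>log 2 (real (n + r))\<rceil> = int k"
      using nonneg_int_cases by blast
    then have "2 * r + s \<le> 2 ^ k"
      using ceiling_log2_le_iff[OF n(2), of k] n(1) by simp
    then show ?thesis
      using least cross_intersecting_if_le k by simp
  qed
  moreover have "int ?i = \<lceil>log 2 (real (n + r))\<rceil>" if "r \<le> 4"
  proof (rule antisym[OF upper])
    show "\<lceil>log 2 (real (n + r))\<rceil> \<le> int ?i"
      using cross_intersecting_imp_le[OF cross assms(1,2) that] ceiling_log2_le_iff[OF n(2)] n(1)
      by metis
  qed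
  moreover have "r \<le> 2 ^ ?i" "s \<le> b_num r ?i"
    using cross by (simp_all add: cross_intersecting_iff_le_b_num)
  moreover have "1 \<le> ?i"
  proof (rule ccontr)
    assume "\<not> 1 \<le> ?i"
    then have "?i = 0"
      by simp
    then have "cross_intersecting 0 r s"
      using cross by simp
    then obtain A B :: "nat set set"
      where AB: "A \<subseteq> {{}}" "card A = r" "card B = s" "\<forall>a\<in>A. \<forall>b\<in>B. a \<inter> b \<noteq> {}"
      unfolding cross_intersecting_def by auto
    have "A \<noteq> {}" "B \<noteq> {}"
      using assms(1,2) AB(2,3) by force+
    then show False
      using AB(1,4) by blast
  qed
  moreover have "\<forall>m\<ge>1. r \<le> 2 ^ m \<and> s \<le> b_num r m \<longrightarrow> ?i \<le> m"
    using least by (simp add: cross_intersecting_iff_le_b_num)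
  moreover have "int (interference_index G {U}) = \<lceil>log 2 (real (n + 1))\<rceil>"
    using side_index_eq assms(3,7,8) by simp
  moreover have "int (interference_index G {W}) = \<lceil>log 2 (real (n + 1))\<rceil>"
    using complete_bipartite.side_index_eq[OF swap] assms(3,7,8) by (simp add: add.commute)
  moreover have "interference_index G P = ?i" if "\<forall>u\<in>U. \<forall>w\<in>W. {u, w} \<in> P" for P
    using index_eq_Least_cross_intersecting that universal_index_eq_Least_cross_intersecting
    by simp
  ultimately show ?thesis
    by simp
qed

end
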